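(* The positive integers that are expressible as a sum of an odd number of consecutive positive integers and are not expressible as a sum of an even number of consecutive positive integers are exactly the even numbers of the form $2^n\cdot(2m+1)$ with $m$ and $n$ positive integers such that $2m+1<2^{n+1}$.
   Context: A sum of consecutive positive integers is a sum $a+(a+1)+\cdots+(a+r-1)$ with $r\ge 2$ terms, where $a$ is a positive integer; it is a sum of an odd (respectively even) number of consecutive positive integers if $r$ is odd (respectively even). *)

theory Defs
  imports Main
begin

definition sum_of_consecutive :: "nat \<Rightarrow> nat \<Rightarrow> bool" where
  "sum_of_consecutive r N \<longleftrightarrow> r \<ge> 2 \<and> (\<exists>a>0. N = (\<Sum>i<r. a + i))"

definition sum_of_odd_number_consecutive :: "nat \<Rightarrow> bool" where
  "sum_of_odd_number_consecutive N \<longleftrightarrow> (\<exists>r. odd r \<and> sum_of_consecutive r N)"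

definition sum_of_even_number_consecutive :: "nat \<Rightarrow> bool" where
  "sum_of_even_number_consecutive N \<longleftrightarrow> (\<exists>r. even r \<and> sum_of_consecutive r N)"

end

theory Submission
  imports Defs
begin

text \<open>
  A sum of \<open>r\<close> consecutive integers is half the product of \<open>r\<close> and the sum of its first and last
  terms, two factors of opposite parity. Hence representing \<open>N\<close> as such a sum amounts to a
  factorization \<open>N = d * s\<close> with \<open>d\<close> odd: if \<open>1 < d < 2 * s\<close> then \<open>d\<close> is the number of terms and
  \<open>s\<close> their mean (lemma \<open>sum_of_odd_number_consecutive_iff\<close>), and if \<open>2 * s < d\<close> then \<open>2 * s\<close> is the
  number of terms and \<open>d\<close> is the sum of the first and the last one (lemma
  \<open>sum_of_even_number_consecutive_iff\<close>).

  Now write \<open>N = 2 ^ n * q\<close> with \<open>q\<close> odd. The factorization \<open>d = q\<close>, \<open>s = 2 ^ n\<close> has the largest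
  odd factor and the smallest cofactor of all (lemma \<open>odd_factor_bounds\<close>), so it decides everything: none of the
  factorizations has an even number of terms iff this one does not, that is iff \<open>q < 2 ^ (n + 1)\<close>.
  In that case it is itself a representation with \<open>q\<close> terms, unless \<open>q = 1\<close>; and if \<open>q = 1\<close> the
  only odd divisor of \<open>N\<close> is \<open>1\<close>, so that no sum of an odd number of terms is possible. Finally
  \<open>1 < q < 2 ^ (n + 1)\<close> forces \<open>n > 0\<close>.
\<close>

lemma double_sum_consecutive:
  fixes a r :: nat
  assumes "a > 0"
  shows "2 * (\<Sum>i<r. a + i) = r * (2 * a + r - 1)"
proof (induction r)
  case (Suc r)
  then show ?case
    using assms by (cases a) (simp_all add: algebra_simps)
qed simp

lemma sum_consecutive_odd_length:
  fixes a k :: nat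
  assumes "a > 0"
  shows "(\<Sum>i<2 * k + 1. a + i) = (2 * k + 1) * (a + k)"
proof -
  have "2 * (\<Sum>i<2 * k + 1. a + i) = (2 * k + 1) * (2 * (a + k))"
    using double_sum_consecutive[OF assms, of "2 * k + 1"] by simp
  also have "\<dots> = 2 * ((2 * k + 1) * (a + k))"
    by (simp only: mult.left_commute)
  finally show ?thesis
    by (simp only: mult_cancel1) simp
qed

lemma sum_consecutive_even_length:
  fixes a s :: nat
  assumes "a > 0"
  shows "(\<Sum>i<2 * s. a + i) = (2 * (a + s) - 1) * s"
proof -
  have "2 * (\<Sum>i<2 * s. a + i) = 2 * ((2 * (a + s) - 1) * s)"
    using double_sum_consecutive[OF assms, of "2 * s"] by (simp add: algebra_simps)
  then show ?thesis
    by simp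
qed

lemma sum_of_odd_number_consecutive_iff:
  "sum_of_odd_number_consecutive N \<longleftrightarrow>
     (\<exists>d s. odd d \<and> d > 1 \<and> N = d * s \<and> d < 2 * s)"
proof
  assume "sum_of_odd_number_consecutive N"
  then obtain r a where r: "odd r" "r \<ge> 2" and a: "a > 0" and N: "N = (\<Sum>i<r. a + i)"
    unfolding sum_of_odd_number_consecutive_def sum_of_consecutive_def by blast
  from r obtain k where k: "r = 2 * k + 1"
    by (blast elim: oddE)
  have "N = r * (a + k)"
    using sum_consecutive_odd_length[OF a, of k] by (simp only: N k)
  moreover have "r < 2 * (a + k)"
    using a k by simp
  moreover have "r > 1"
    using r by simp
  ultimately show "\<exists>d s. odd d \<and> d > 1 \<and> N = d * s \<and> d < 2 * s"
    using r by blast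
next
  assume "\<exists>d s. odd d \<and> d > 1 \<and> N = d * s \<and> d < 2 * s"
  then obtain d s where ds: "odd d" "d > 1" "N = d * s" "d < 2 * s"
    by blast
  then obtain k where k: "d = 2 * k + 1"
    by (blast elim: oddE)
  with ds have a: "s - k > 0" and s: "s - k + k = s"
    by simp_all
  have "N = (\<Sum>i<d. (s - k) + i)"
    using sum_consecutive_odd_length[OF a, of k] by (simp only: ds k s)
  moreover have "d \<ge> 2"
    using ds by simp
  ultimately show "sum_of_odd_number_consecutive N"
    unfolding sum_of_odd_number_consecutive_def sum_of_consecutive_def
    using a ds(1) by blast
qed

lemma sum_of_even_number_consecutive_iff:
  "sum_of_even_number_consecutive N \<longleftrightarrow>
     (\<exists>d s. odd d \<and> s > 0 \<and> N = d * s \<and> 2 * s < d)"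
proof
  assume "sum_of_even_number_consecutive N"
  then obtain r a where r: "even r" "r \<ge> 2" and a: "a > 0" and N: "N = (\<Sum>i<r. a + i)"
    unfolding sum_of_even_number_consecutive_def sum_of_consecutive_def by blast
  from r obtain s where s: "r = 2 * s"
    by (blast elim: evenE)
  have "N = (2 * (a + s) - 1) * s"
    using sum_consecutive_even_length[OF a, of s] by (simp only: N s)
  moreover have "odd (2 * (a + s) - 1)" "2 * s < 2 * (a + s) - 1" "s > 0"
    using a r s by auto
  ultimately show "\<exists>d s. odd d \<and> s > 0 \<and> N = d * s \<and> 2 * s < d"
    by blast
next
  assume "\<exists>d s. odd d \<and> s > 0 \<and> N = d * s \<and> 2 * s < d"
  then obtain d s where ds: "odd d" "s > 0" "N = d * s" "2 * s < d"
    by blast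
  then obtain k where k: "d = 2 * k + 1"
    by (blast elim: oddE)
  \<comment> \<open>The first and the last term add up to \<open>d\<close> and differ by \<open>2 * s - 1\<close>.\<close>
  define a where "a = k + 1 - s"
  have a: "a > 0" and d: "2 * (a + s) - 1 = d"
    using ds k by (simp_all add: a_def)
  have "N = (\<Sum>i<2 * s. a + i)"
    using sum_consecutive_even_length[OF a, of s] by (simp only: ds d)
  moreover have "even (2 * s)" "2 * s \<ge> 2"
    using ds by simp_all
  ultimately show "sum_of_even_number_consecutive N"
    unfolding sum_of_even_number_consecutive_def sum_of_consecutive_def
    using a by blast
qed

text \<open>
  The powers of two in \<open>d * s\<close> all lie in \<open>s\<close> when \<open>d\<close> is odd; dually, \<open>d\<close> divides the odd part.
\<close>

lemma odd_factor_bounds: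
  fixes d s q n :: nat
  assumes "odd d" "odd q" and eq: "d * s = 2 ^ n * q" and "s > 0"
  shows "d \<le> q" "2 ^ n \<le> s"
proof -
  have "coprime d (2 ^ n)"
    using \<open>odd d\<close> by simp
  moreover have "d dvd 2 ^ n * q"
    using eq by (metis dvd_triv_left)
  ultimately have "d dvd q"
    by (simp add: coprime_dvd_mult_right_iff)
  moreover have "q > 0"
    using \<open>odd q\<close> by (rule odd_pos)
  ultimately show "d \<le> q"
    by (rule dvd_imp_le)
  have "coprime (2 ^ n) d"
    using \<open>odd d\<close> by simp
  moreover have "2 ^ n dvd d * s"
    using eq by simp
  ultimately have "2 ^ n dvd s"
    by (simp add: coprime_dvd_mult_right_iff)
  then show "2 ^ n \<le> s"
    using \<open>s > 0\<close> by (rule dvd_imp_le)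
qed

lemma odd_not_even_consecutive_iff:
  fixes q n :: nat
  assumes "odd q"
  shows "sum_of_odd_number_consecutive (2 ^ n * q) \<and> \<not> sum_of_even_number_consecutive (2 ^ n * q)
           \<longleftrightarrow> 1 < q \<and> q < 2 ^ (n + 1)"
proof
  assume *: "sum_of_odd_number_consecutive (2 ^ n * q) \<and>
             \<not> sum_of_even_number_consecutive (2 ^ n * q)"
  then obtain d s where ds: "odd d" "d > 1" "d * s = 2 ^ n * q" "d < 2 * s"
    unfolding sum_of_odd_number_consecutive_iff by auto
  then have "d \<le> q"
    using odd_factor_bounds(1)[OF _ assms, of d s n] by simp
  have "2 ^ n * q = q * 2 ^ n" "(2::nat) ^ n > 0"
    by simp_all
  then have "\<not> 2 * 2 ^ n < q"
    using * assms unfolding sum_of_even_number_consecutive_iff by blast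
  moreover have "q \<noteq> 2 * 2 ^ n"
    using assms by auto
  ultimately show "1 < q \<and> q < 2 ^ (n + 1)"
    using \<open>d > 1\<close> \<open>d \<le> q\<close> by simp
next
  assume q: "1 < q \<and> q < 2 ^ (n + 1)"
  then have q2: "q < 2 * 2 ^ n"
    by simp
  have "2 ^ n * q = q * 2 ^ n"
    by simp
  with q2 have "sum_of_odd_number_consecutive (2 ^ n * q)"
    unfolding sum_of_odd_number_consecutive_iff using assms q by blast
  moreover have "\<not> 2 * s < d" if "odd d" "s > 0" "2 ^ n * q = d * s" for d s
    using odd_factor_bounds[OF that(1) assms that(3)[symmetric] that(2)] q2
    by linarith
  ultimately show "sum_of_odd_number_consecutive (2 ^ n * q) \<and>
                   \<not> sum_of_even_number_consecutive (2 ^ n * q)"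
    unfolding sum_of_even_number_consecutive_iff by blast
qed

lemma nat_eq_power_two_times_odd:
  fixes N :: nat
  assumes "N > 0"
  obtains n q where "odd q" "N = 2 ^ n * q"
proof -
  have "\<exists>n q. odd q \<and> N = 2 ^ n * q"
    using assms
  proof (induction N rule: less_induct)
    case (less N)
    show ?case
    proof (cases "even N")
      case True
      then obtain M where M: "N = 2 * M"
        by (rule evenE)
      with less.prems have "M < N" "M > 0"
        by simp_all
      with less.IH obtain n q where "odd q" "M = 2 ^ n * q"
        by blast
      with M show ?thesis
        by (intro exI[of _ "Suc n"] exI[of _ q]) simp
    next
      case False
      then show ?thesis
        by (intro exI[of _ 0] exI[of _ N]) simp
    qed
  qed
  with that show thesis
    by blast
qed

theorem mainTheorem8:
  shows "{N :: nat. N > 0 \<and> sum_of_odd_number_consecutive N \<and> \<not> sum_of_even_number_consecutive N}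
       = {N :: nat. even N \<and> (\<exists>m n :: nat. m > 0 \<and> n > 0 \<and> N = 2 ^ n * (2 * m + 1) \<and> 2 * m + 1 < 2 ^ (n + 1))}"
proof (intro set_eqI iffI; unfold mem_Collect_eq)
  fix N :: nat
  assume N: "N > 0 \<and> sum_of_odd_number_consecutive N \<and> \<not> sum_of_even_number_consecutive N"
  then have "N > 0"
    by blast
  then obtain n q where nq: "odd q" "N = 2 ^ n * q"
    by (rule nat_eq_power_two_times_odd)
  with N have q: "1 < q" "q < 2 ^ (n + 1)"
    using odd_not_even_consecutive_iff[OF nq(1), of n] by simp_all
  obtain m where m: "q = 2 * m + 1"
    using nq(1) by (rule oddE)
  have "n > 0"
    using q by (cases n) simp_all
  moreover have "m > 0"
    using q m by simp
  moreover have "even N"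
    using nq \<open>n > 0\<close> by simp
  ultimately show "even N \<and> (\<exists>m n :: nat. m > 0 \<and> n > 0 \<and> N = 2 ^ n * (2 * m + 1) \<and> 2 * m + 1 < 2 ^ (n + 1))"
    using nq(2) q(2) unfolding m by blast
next
  fix N :: nat
  assume "even N \<and> (\<exists>m n :: nat. m > 0 \<and> n > 0 \<and> N = 2 ^ n * (2 * m + 1) \<and> 2 * m + 1 < 2 ^ (n + 1))"
  then obtain m n :: nat
    where mn: "m > 0" "N = 2 ^ n * (2 * m + 1)" "2 * m + 1 < 2 ^ (n + 1)"
    by blast
  have "1 < 2 * m + 1" "odd (2 * m + 1)" "N > 0"
    using mn by simp_all
  then show "N > 0 \<and> sum_of_odd_number_consecutive N \<and> \<not> sum_of_even_number_consecutive N"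
    using odd_not_even_consecutive_iff[of "2 * m + 1" n] by (simp only: mn) simp
qed

end
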